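(* Let $G=(\Xi,E)$ be a finite oriented graph with edge weight $\lambda$ and vertex weight $\mu$, let $f\in\ell^2(E)$, and let $S\in\Xi$. Let the canonical Markov chain be defined on the weighted graph $(G,\lambda)$, and let $V_f^S$ be the associated value function $V_f^S(T)=\mathbb{E}[\mathcal{I}_f^S(T)]$. Then $V_f^S$ solves the Poisson equation $$\mathrm{d}^*\mathrm{d}V_f^S=\mathrm{d}^*f$$ on the connected component of $G$ to which the state $S$ belongs.
   Context: Graph. $\Xi$ is a finite set of vertices (states) and $E\subseteq \Xi\times\Xi$ is a set of oriented edges between distinct vertices such that at most one of $(S,T)$ and $(T,S)$ belongs to $E$ for all $S,T\in\Xi$. Write $S\sim T$ (adjacent) if $(S,T)\in E$ or $(T,S)\in E$. The edge weight is a strictly positive function $\lambda:E\to(0,\infty)$, extended symmetrically by $\lambda(T,S)=\lambda(S,T)$ (and $\lambda(S,T)=0$ if $S\not\sim T$). The vertex weight is a strictly positive function $\mu:\Xi\to(0,\infty)$. Connectedness and connected components refer to chains of edges traversed in either direction. Function spaces and operators. $\ell^2_\mu(\Xi)$ is the space of functions $\Xi\to\mathbb{R}$ with inner product $\langle u,v\rangle_\mu=\sum_{S\in\Xi}\mu(S)u(S)v(S)$. $\ell^2_\lambda(E)$ is the space of functions $f:E\to\mathbb{R}$ with inner product $\langle f,g\rangle_\lambda=\sum_{(S,T)\in E}\lambda(S,T)f(S,T)g(S,T)$, with the convention $f(T,S):=-f(S,T)$ for reversed edges; $\ell^2(E)$ denotes the same space of functions when the inner product is irrelevant. The gradient is $\mathrm{d}u(S,T)=u(T)-u(S)$,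 and $\mathrm{d}^*$ is its adjoint, $\langle \mathrm{d}v,f\rangle_\lambda=\langle v,\mathrm{d}^*f\rangle_\mu$, explicitly $$\mathrm{d}^*f(S)=\sum_{T\sim S}\frac{\lambda(T,S)}{\mu(S)}f(T,S).$$ Markov chain. For $S\in\Xi$, $(X^S_n)_{n\ge 0}$ is the Markov chain on $\Xi$ with $X^S_0=S$ and transition probabilities $p_{A,B}=\lambda(A,B)/\sum_{U\sim A}\lambda(A,U)$ if $B\sim A$ and $p_{A,B}=0$ otherwise, defined on a probability space $(\Omega,\mathcal{F},\mathcal{P})$. Value function. For $S,T$ in the same connected component, $\tau_{S,T}\in\{0,1,2,\dots\}$ is the first time $n\ge 0$ at which $X^S_n=T$ (so $\tau_{S,S}=0$). For $f\in\ell^2(E)$, $$\mathcal{I}_f^S(T)=\sum_{n=1}^{\tau_{S,T}}f\big(X^S_{n-1},X^S_n\big),\qquad V_f^S(T)=\mathbb{E}\big[\mathcal{I}_f^S(T)\big]=\int_\Omega \mathcal{I}_f^S(T)(\omega)\,d\mathcal{P}(\omega).$$ *)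

theory Defs
  imports "HOL-Probability.Probability"
begin

locale weighted_oriented_graph =
  fixes \<Xi> :: "'a set" and E :: "('a \<times> 'a) set"
    and lam :: "'a \<Rightarrow> 'a \<Rightarrow> real" and mu :: "'a \<Rightarrow> real"
  assumes finite_vertices: "finite \<Xi>"
    and edges_subset: "E \<subseteq> \<Xi> \<times> \<Xi>"
    and edges_distinct: "(S, T) \<in> E \<Longrightarrow> S \<noteq> T"
    and edges_oriented: "(S, T) \<in> E \<Longrightarrow> (T, S) \<notin> E"
    and edge_weight_pos: "(S, T) \<in> E \<Longrightarrow> lam S T > 0"
    and vertex_weight_pos: "S \<in> \<Xi> \<Longrightarrow> mu S > 0"

definition adjacent :: "('a \<times> 'a) set \<Rightarrow> 'a \<Rightarrow> 'a \<Rightarrow> bool" where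
  "adjacent E S T \<longleftrightarrow> (S, T) \<in> E \<or> (T, S) \<in> E"

definition component :: "'a set \<Rightarrow> ('a \<times> 'a) set \<Rightarrow> 'a \<Rightarrow> 'a set" where
  "component \<Xi> E S = {T \<in> \<Xi>. (S, T) \<in> (E \<union> E\<inverse>)\<^sup>*}"

text \<open>Functions on \<open>E\<close> are curried functions of two vertices of which only the values on pairs in
  \<open>E\<close> matter: edge weights are read through their symmetric extension, all other edge functions
  through their antisymmetric extension.\<close>

definition sym_ext :: "('a \<times> 'a) set \<Rightarrow> ('a \<Rightarrow> 'a \<Rightarrow> real) \<Rightarrow> 'a \<Rightarrow> 'a \<Rightarrow> real" where
  "sym_ext E lam S T = (if (S, T) \<in> E then lam S T else if (T, S) \<in> E then lam T S else 0)"

definition flow_ext :: "('a \<times> 'a) set \<Rightarrow> ('a \<Rightarrow> 'a \<Rightarrow> real) \<Rightarrow> 'a \<Rightarrow> 'a \<Rightarrow> real" where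
  "flow_ext E f S T = (if (S, T) \<in> E then f S T else if (T, S) \<in> E then - f T S else 0)"

definition inner_vertices :: "'a set \<Rightarrow> ('a \<Rightarrow> real) \<Rightarrow> ('a \<Rightarrow> real) \<Rightarrow> ('a \<Rightarrow> real) \<Rightarrow> real" where
  "inner_vertices \<Xi> mu u v = (\<Sum>S\<in>\<Xi>. mu S * u S * v S)"

definition inner_edges ::
  "('a \<times> 'a) set \<Rightarrow> ('a \<Rightarrow> 'a \<Rightarrow> real) \<Rightarrow> ('a \<Rightarrow> 'a \<Rightarrow> real) \<Rightarrow> ('a \<Rightarrow> 'a \<Rightarrow> real) \<Rightarrow> real" where
  "inner_edges E lam f g = (\<Sum>(S, T)\<in>E. lam S T * f S T * g S T)"

definition grad :: "('a \<Rightarrow> real) \<Rightarrow> 'a \<Rightarrow> 'a \<Rightarrow> real" where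
  "grad u S T = u T - u S"

definition grad_adj :: "'a set \<Rightarrow> ('a \<times> 'a) set \<Rightarrow> ('a \<Rightarrow> 'a \<Rightarrow> real) \<Rightarrow> ('a \<Rightarrow> real)
    \<Rightarrow> ('a \<Rightarrow> 'a \<Rightarrow> real) \<Rightarrow> 'a \<Rightarrow> real" where
  "grad_adj \<Xi> E lam mu f S =
     (\<Sum>T | T \<in> \<Xi> \<and> adjacent E T S. sym_ext E lam T S / mu S * flow_ext E f T S)"

lemma (in weighted_oriented_graph) grad_adjoint:
  "inner_edges E lam (grad v) f = inner_vertices \<Xi> mu v (grad_adj \<Xi> E lam mu f)"
proof -
  have fin: "finite (\<Xi> \<times> \<Xi>)" using finite_vertices by simp
  define g where "g S T = (if (S, T) \<in> E then lam S T * f S T else 0)" for S T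
  have g: "sym_ext E lam T S * flow_ext E f T S = g T S - g S T" for S T
    using edges_oriented[of S T] by (auto simp: sym_ext_def flow_ext_def g_def)
  have L: "inner_edges E lam (grad v) f = (\<Sum>S\<in>\<Xi>. \<Sum>T\<in>\<Xi>. (v T - v S) * g S T)"
  proof -
    have "inner_edges E lam (grad v) f = (\<Sum>(S, T)\<in>E. (v T - v S) * g S T)"
      unfolding inner_edges_def by (rule sum.cong) (auto simp: grad_def g_def)
    also have "\<dots> = (\<Sum>(S, T)\<in>\<Xi> \<times> \<Xi>. (v T - v S) * g S T)"
      by (rule sum.mono_neutral_left[OF fin edges_subset]) (auto simp: g_def)
    finally show ?thesis by (simp add: sum.cartesian_product)
  qed
  have R: "mu S * v S * grad_adj \<Xi> E lam mu f S = (\<Sum>T\<in>\<Xi>. v S * (g T S - g S T))"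
    if "S \<in> \<Xi>" for S
  proof -
    have "mu S * v S * grad_adj \<Xi> E lam mu f S =
        (\<Sum>T | T \<in> \<Xi> \<and> adjacent E T S. v S * (g T S - g S T))"
      unfolding grad_adj_def sum_distrib_left
      using vertex_weight_pos[OF that] by (intro sum.cong) (auto simp: g[symmetric])
    also have "\<dots> = (\<Sum>T\<in>\<Xi>. v S * (g T S - g S T))"
      by (rule sum.mono_neutral_left[OF finite_vertices]) (auto simp: g_def adjacent_def)
    finally show ?thesis .
  qed
  have "inner_vertices \<Xi> mu v (grad_adj \<Xi> E lam mu f)
      = (\<Sum>S\<in>\<Xi>. \<Sum>T\<in>\<Xi>. v S * g T S) - (\<Sum>S\<in>\<Xi>. \<Sum>T\<in>\<Xi>. v S * g S T)"
    by (simp add: inner_vertices_def R right_diff_distrib sum_subtractf)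
  also have "(\<Sum>S\<in>\<Xi>. \<Sum>T\<in>\<Xi>. v S * g T S) = (\<Sum>S\<in>\<Xi>. \<Sum>T\<in>\<Xi>. v T * g S T)"
    by (rule sum.swap)
  finally show ?thesis
    by (simp add: L left_diff_distrib sum_subtractf)
qed

definition trans_prob ::
  "'a set \<Rightarrow> ('a \<times> 'a) set \<Rightarrow> ('a \<Rightarrow> 'a \<Rightarrow> real) \<Rightarrow> 'a \<Rightarrow> 'a \<Rightarrow> real" where
  "trans_prob \<Xi> E lam A B =
     (if adjacent E B A
      then sym_ext E lam A B / (\<Sum>U | U \<in> \<Xi> \<and> adjacent E U A. sym_ext E lam A U) else 0)"

text \<open>The transition law is required only at states with at least one neighbour: at an isolated
  state the transition probabilities sum to \<open>0\<close>, so no process could obey them there. An isolated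
  state is visited only by a chain starting in it, for which the hitting time of its connected
  component, the singleton, is \<open>0\<close> whatever the later steps are.\<close>

definition canonical_chain :: "'a set \<Rightarrow> ('a \<times> 'a) set \<Rightarrow> ('a \<Rightarrow> 'a \<Rightarrow> real)
    \<Rightarrow> 'w measure \<Rightarrow> 'a \<Rightarrow> (nat \<Rightarrow> 'w \<Rightarrow> 'a) \<Rightarrow> bool" where
  "canonical_chain \<Xi> E lam M S X \<longleftrightarrow>
     prob_space M \<and>
     (\<forall>n. X n \<in> measurable M (count_space \<Xi>)) \<and>
     (\<forall>\<omega>\<in>space M. X 0 \<omega> = S) \<and>
     (\<forall>n x B. (\<exists>U. adjacent E U (x n)) \<longrightarrow>
        measure M {\<omega> \<in> space M. (\<forall>i\<le>n. X i \<omega> = x i) \<and> X (Suc n) \<omega> = B} =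
        measure M {\<omega> \<in> space M. \<forall>i\<le>n. X i \<omega> = x i} * trans_prob \<Xi> E lam (x n) B)"

text \<open>The value \<open>0\<close> on trajectories that never reach \<open>T\<close> is immaterial: for \<open>T\<close> in the component of
  the starting state they form a null set.\<close>

definition hitting_time :: "(nat \<Rightarrow> 'w \<Rightarrow> 'a) \<Rightarrow> 'a \<Rightarrow> 'w \<Rightarrow> nat" where
  "hitting_time X T \<omega> = (if \<exists>n. X n \<omega> = T then LEAST n. X n \<omega> = T else 0)"

definition path_integral ::
  "('a \<times> 'a) set \<Rightarrow> (nat \<Rightarrow> 'w \<Rightarrow> 'a) \<Rightarrow> ('a \<Rightarrow> 'a \<Rightarrow> real) \<Rightarrow> 'a \<Rightarrow> 'w \<Rightarrow> real" where
  "path_integral E X f T \<omega> =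
     (\<Sum>n = 1..hitting_time X T \<omega>. flow_ext E f (X (n - 1) \<omega>) (X n \<omega>))"

definition value_fun :: "('a \<times> 'a) set \<Rightarrow> 'w measure \<Rightarrow> (nat \<Rightarrow> 'w \<Rightarrow> 'a)
    \<Rightarrow> ('a \<Rightarrow> 'a \<Rightarrow> real) \<Rightarrow> 'a \<Rightarrow> real" where
  "value_fun E M X f T = (LINT \<omega>|M. path_integral E X f T \<omega>)"

end

theory Submission
  imports Defs
begin

text \<open>Up to an additive constant the value function is a potential of the edge function. Orthogonal
  projection of \<open>f\<close> onto the gradients gives \<open>\<phi>\<close> with \<open>d\<^sup>* d \<phi> = d\<^sup>* f\<close> (\<open>ex_potential\<close>). At a
  vertex that is not isolated, the mean of \<open>k (A, \<cdot>)\<close> under one step of the walk from \<open>A\<close>, called the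
  drift of \<open>k\<close> at \<open>A\<close>, is a negative multiple of \<open>d\<^sup>* k (A)\<close> for an antisymmetric \<open>k\<close>, so \<open>f\<close> and
  \<open>d \<phi>\<close> have the same drift. By the Markov property the expected sum of \<open>k\<close> along the walk up to the
  hitting time \<open>\<tau>\<close> of \<open>T\<close> depends on \<open>k\<close> only through its drift: the step from time \<open>n\<close> to \<open>n + 1\<close>
  counts if \<open>\<tau> > n\<close>, and this event is decided by the first \<open>n\<close> steps. Hence \<open>f\<close> may be replaced
  by \<open>d \<phi>\<close>, whose sum telescopes to \<open>\<phi> T - \<phi> S\<close>. This is \<open>value_fun_eq_potential_difference\<close>; since
  the component contains all neighbours of its vertices, \<open>V\<close> and \<open>\<phi>\<close> have the same \<open>d\<^sup>* d\<close> on it.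

  Summing the expectations step by step is legitimate because \<open>\<tau>\<close> has finite mean
  (\<open>summable_alive\<close>). For this, the Poisson equation is used once more: there is a function \<open>w\<close> whose
  gradient has drift \<open>- 1\<close> at all vertices of the component other than \<open>T\<close> (\<open>ex_time_potential\<close>).
  Along the walk \<open>w\<close> decreases by \<open>1\<close> per step on average until \<open>T\<close> is hit, and it is bounded since
  there are finitely many vertices, so \<open>min \<tau> N\<close> has a mean bounded uniformly in \<open>N\<close>.\<close>

section \<open>Solving the Poisson equation\<close>

text \<open>Least squares: the residual of the best approximation of \<open>y\<close> by combinations of finitely many
  vectors is orthogonal to each of them. The induction is the Gram-Schmidt process; the inner product
  is positive definite on functions on \<open>F\<close>.\<close>
lemma normal_equations:
  fixes w y :: "'e \<Rightarrow> real" and v :: "'i \<Rightarrow> 'e \<Rightarrow> real"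
  assumes "finite I" and "finite F" and pos: "\<And>e. e \<in> F \<Longrightarrow> w e > 0"
  shows "\<exists>c. \<forall>j\<in>I. (\<Sum>e\<in>F. w e * (y e - (\<Sum>i\<in>I. c i * v i e)) * v j e) = 0"
  using assms(1)
proof (induction I arbitrary: y rule: finite_induct)
  case empty
  show ?case by simp
next
  case (insert i I)
  define ip where "ip x z = (\<Sum>e\<in>F. w e * x e * z e)" for x z :: "'e \<Rightarrow> real"
  have ip_diff: "ip (\<lambda>e. x e - a * x' e) z = ip x z - a * ip x' z" for x x' z a
    by (simp add: ip_def algebra_simps sum_subtractf sum_distrib_left)
  have ip_comb: "ip x (\<lambda>e. \<Sum>j\<in>I. c j * v j e) = (\<Sum>j\<in>I. c j * ip x (v j))" for x c
  proof -
    have "ip x (\<lambda>e. \<Sum>j\<in>I. c j * v j e) = (\<Sum>e\<in>F. \<Sum>j\<in>I. c j * (w e * x e * v j e))"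
      unfolding ip_def sum_distrib_left by (intro sum.cong refl) (simp add: algebra_simps)
    also have "\<dots> = (\<Sum>j\<in>I. c j * ip x (v j))"
      unfolding ip_def sum_distrib_left by (rule sum.swap)
    finally show ?thesis .
  qed
  obtain c where c: "\<forall>j\<in>I. ip (\<lambda>e. y e - (\<Sum>i\<in>I. c i * v i e)) (v j) = 0"
    using insert.IH[of y] unfolding ip_def by blast
  obtain c' where c': "\<forall>j\<in>I. ip (\<lambda>e. v i e - (\<Sum>i\<in>I. c' i * v i e)) (v j) = 0"
    using insert.IH[of "v i"] unfolding ip_def by blast
  define ry where "ry e = y e - (\<Sum>i\<in>I. c i * v i e)" for e
  define r where "r e = v i e - (\<Sum>i\<in>I. c' i * v i e)" for e
  have ry: "ip ry (v j) = 0" if "j \<in> I" for j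
    using c that unfolding ry_def[abs_def] by blast
  have r: "ip r (v j) = 0" if "j \<in> I" for j
    using c' that unfolding r_def[abs_def] by blast
  have vi: "ip x (v i) = ip x r" if "\<And>j. j \<in> I \<Longrightarrow> ip x (v j) = 0" for x
  proof -
    have "ip x r = ip x (v i) - ip x (\<lambda>e. \<Sum>j\<in>I. c' j * v j e)"
      by (simp add: ip_def r_def right_diff_distrib sum_subtractf)
    then show ?thesis using that by (simp add: ip_comb)
  qed
  \<comment> \<open>If \<open>r\<close> vanishes on \<open>F\<close>, then \<open>v i\<close> is a combination of the earlier vectors; the division by zero
    then gives the coefficient \<open>0\<close>.\<close>
  define a where "a = ip ry r / ip r r"
  have orth: "ip (\<lambda>e. ry e - a * r e) r = 0"
  proof (cases "ip r r = 0")
    case True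
    have "\<forall>e\<in>F. w e * r e * r e = 0"
      using True pos \<open>finite F\<close> unfolding ip_def
      by (subst (asm) sum_nonneg_eq_0_iff) (auto simp: mult.assoc less_imp_le)
    then have "\<forall>e\<in>F. r e = 0" using pos by fastforce
    then show ?thesis by (simp add: ip_def)
  next
    case False
    then show ?thesis unfolding ip_diff by (simp add: a_def)
  qed
  have perp: "ip (\<lambda>e. ry e - a * r e) (v j) = 0" if "j \<in> insert i I" for j
  proof (cases "j = i")
    case True
    then show ?thesis using orth by (subst True, subst vi) (simp_all add: ip_diff r ry)
  next
    case False
    then show ?thesis using that by (simp add: ip_diff r ry)
  qed
  define d where "d j = (if j = i then a else c j - a * c' j)" for j
  have "ry e - a * r e = y e - (\<Sum>j\<in>insert i I. d j * v j e)" for e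
  proof -
    have "(\<Sum>j\<in>I. d j * v j e) = (\<Sum>j\<in>I. (c j - a * c' j) * v j e)"
      using insert.hyps(2) by (intro sum.cong) (auto simp: d_def)
    then show ?thesis
      using insert.hyps
      by (simp add: d_def ry_def r_def algebra_simps sum_subtractf sum_distrib_left sum.distrib)
  qed
  then have "\<forall>j\<in>insert i I. (\<Sum>e\<in>F. w e * (y e - (\<Sum>j\<in>insert i I. d j * v j e)) * v j e) = 0"
    using perp unfolding ip_def by simp
  then show ?case by blast
qed

context weighted_oriented_graph
begin

lemma finite_edges: "finite E"
  using finite_vertices edges_subset by (meson finite_SigmaI finite_subset)

lemma adjacent_vertices: "adjacent E A B \<Longrightarrow> A \<in> \<Xi> \<and> B \<in> \<Xi>"
  using edges_subset by (auto simp: adjacent_def)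

lemma sym_ext_commute: "sym_ext E lam A B = sym_ext E lam B A"
  using edges_oriented by (auto simp: sym_ext_def)

lemma flow_ext_swap: "flow_ext E g A B = - flow_ext E g B A"
  using edges_oriented by (auto simp: flow_ext_def)

lemma sym_ext_pos_iff: "0 < sym_ext E lam A B \<longleftrightarrow> adjacent E A B"
  using edge_weight_pos by (auto simp: sym_ext_def adjacent_def)

lemma sym_ext_zero: "\<not> adjacent E A B \<Longrightarrow> sym_ext E lam A B = 0"
  by (auto simp: sym_ext_def adjacent_def)

lemma adjacent_commute: "adjacent E A B \<longleftrightarrow> adjacent E B A"
  by (auto simp: adjacent_def)

text \<open>Adjointness tested against the indicator function of the vertex \<open>A\<close>.\<close>
lemma grad_adj_as_edge_sum:
  assumes "A \<in> \<Xi>"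
  shows "mu A * grad_adj \<Xi> E lam mu g A
       = (\<Sum>(B, C)\<in>E. lam B C * (of_bool (A = C) - of_bool (A = B)) * g B C)"
proof -
  have "inner_edges E lam (grad (\<lambda>C. of_bool (A = C))) g = mu A * grad_adj \<Xi> E lam mu g A"
    using assms finite_vertices
    by (simp add: grad_adjoint inner_vertices_def of_bool_def if_distrib[of "\<lambda>x. _ * x"]
        if_distrib[of "\<lambda>x. x * _"] sum.delta' cong: if_cong)
  then show ?thesis
    by (simp add: inner_edges_def grad_def)
qed

text \<open>The normal equations for approximating \<open>g\<close> by gradients say that the residual \<open>g - d \<phi>\<close> is
  orthogonal to \<open>d 1\<^sub>A\<close> for each vertex \<open>A\<close>, which by adjointness is \<open>d\<^sup>* (g - d \<phi>) = 0\<close> at \<open>A\<close>.\<close>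
lemma ex_potential: "\<exists>\<phi>. \<forall>A\<in>\<Xi>. grad_adj \<Xi> E lam mu (grad \<phi>) A = grad_adj \<Xi> E lam mu g A"
proof -
  \<comment> \<open>\<open>b A\<close> is the gradient of the indicator function of \<open>A\<close>; the gradient of \<open>\<phi>\<close> is the combination
    of these with coefficients \<open>\<phi>\<close>.\<close>
  define b where "b A = (\<lambda>(B, C). of_bool (A = C) - of_bool (A = B) :: real)" for A :: 'a
  obtain \<phi> where \<phi>: "\<forall>A\<in>\<Xi>. (\<Sum>e\<in>E. case_prod lam e *
      (case_prod g e - (\<Sum>i\<in>\<Xi>. \<phi> i * b i e)) * b A e) = 0"
    using normal_equations[of \<Xi> E "case_prod lam" "case_prod g" b]
      finite_vertices finite_edges edge_weight_pos by auto
  have comb: "(\<Sum>i\<in>\<Xi>. \<phi> i * b i (B, C)) = grad \<phi> B C" if "(B, C) \<in> E" for B C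
  proof -
    have "B \<in> \<Xi>" "C \<in> \<Xi>" using that edges_subset by auto
    then show ?thesis
      using finite_vertices
      by (simp add: b_def grad_def right_diff_distrib sum_subtractf of_bool_def
          if_distrib[of "\<lambda>x. _ * x"] sum.delta cong: if_cong)
  qed
  have "grad_adj \<Xi> E lam mu (grad \<phi>) A = grad_adj \<Xi> E lam mu g A" if A: "A \<in> \<Xi>" for A
  proof -
    have bA: "b A (B, C) = of_bool (A = C) - of_bool (A = B)" for B C
      by (simp add: b_def)
    have "0 = (\<Sum>(B, C)\<in>E. lam B C * (of_bool (A = C) - of_bool (A = B)) * g B C
                     - lam B C * (of_bool (A = C) - of_bool (A = B)) * grad \<phi> B C)"
      using bspec[OF \<phi> A, symmetric]
      by (rule trans, intro sum.cong refl) (auto simp: comb bA algebra_simps)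
    also have "\<dots> = mu A * grad_adj \<Xi> E lam mu g A - mu A * grad_adj \<Xi> E lam mu (grad \<phi>) A"
      unfolding grad_adj_as_edge_sum[OF A] by (simp add: sum_subtractf split_beta)
    finally show ?thesis using vertex_weight_pos[OF A] by simp
  qed
  then show ?thesis by blast
qed

section \<open>Drift of edge functions\<close>

definition conductance :: "'a \<Rightarrow> real" where
  "conductance A = (\<Sum>U | U \<in> \<Xi> \<and> adjacent E U A. sym_ext E lam A U)"

definition drift :: "('a \<Rightarrow> 'a \<Rightarrow> real) \<Rightarrow> 'a \<Rightarrow> real" where
  "drift k A = (\<Sum>B\<in>\<Xi>. trans_prob \<Xi> E lam A B * k A B)"

lemma conductance_pos:
  assumes "adjacent E U A" shows "conductance A > 0"
  unfolding conductance_def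
  using assms finite_vertices adjacent_vertices[OF assms]
  by (intro sum_pos) (auto simp: sym_ext_pos_iff adjacent_commute)

text \<open>Detailed balance: the product on the left is symmetric in \<open>A\<close> and \<open>B\<close>. At an isolated vertex both
  sides are \<open>0\<close>.\<close>
lemma conductance_trans_prob: "conductance A * trans_prob \<Xi> E lam A B = sym_ext E lam A B"
proof (cases "adjacent E B A")
  case True
  then show ?thesis
    using conductance_pos[OF True] by (simp add: trans_prob_def conductance_def)
next
  case False
  then show ?thesis by (simp add: trans_prob_def sym_ext_zero adjacent_commute)
qed

lemma conductance_drift: "conductance A * drift k A = (\<Sum>B\<in>\<Xi>. sym_ext E lam A B * k A B)"
  by (simp add: drift_def sum_distrib_left mult.assoc[symmetric] conductance_trans_prob)

lemma conductance_eq_sum: "conductance A = (\<Sum>B\<in>\<Xi>. sym_ext E lam A B)"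
  unfolding conductance_def using finite_vertices
  by (intro sum.mono_neutral_left) (auto simp: sym_ext_zero adjacent_commute)

lemma drift_one:
  assumes "adjacent E U A" shows "drift (\<lambda>_ _. 1) A = 1"
  using conductance_drift[of A "\<lambda>_ _. 1"] conductance_pos[OF assms]
  by (simp add: conductance_eq_sum)

text \<open>The sign comes from orientation: \<open>d\<^sup>*\<close> adds the flow into \<open>A\<close>, the drift averages the flow out
  of \<open>A\<close>.\<close>
lemma conductance_drift_flow_ext:
  assumes "A \<in> \<Xi>"
  shows "conductance A * drift (flow_ext E g) A = - (mu A * grad_adj \<Xi> E lam mu g A)"
proof -
  have "mu A * grad_adj \<Xi> E lam mu g A =
      (\<Sum>U | U \<in> \<Xi> \<and> adjacent E U A. sym_ext E lam U A * flow_ext E g U A)"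
    unfolding grad_adj_def sum_distrib_left
    using vertex_weight_pos[OF assms] by (intro sum.cong) auto
  also have "\<dots> = (\<Sum>U\<in>\<Xi>. sym_ext E lam U A * flow_ext E g U A)"
    using finite_vertices by (intro sum.mono_neutral_left) (auto simp: sym_ext_zero)
  also have "\<dots> = (\<Sum>U\<in>\<Xi>. - (sym_ext E lam A U * flow_ext E g A U))"
    by (intro sum.cong refl) (subst sym_ext_commute, subst flow_ext_swap, simp)
  finally show ?thesis by (simp add: conductance_drift sum_negf)
qed

lemma conductance_drift_grad:
  assumes "A \<in> \<Xi>"
  shows "conductance A * drift (grad u) A = - (mu A * grad_adj \<Xi> E lam mu (grad u) A)"
proof -
  have "sym_ext E lam A B * grad u A B = sym_ext E lam A B * flow_ext E (grad u) A B" for B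
    by (auto simp: sym_ext_def flow_ext_def grad_def)
  then show ?thesis
    unfolding conductance_drift_flow_ext[OF assms, symmetric] by (simp only: conductance_drift)
qed

section \<open>A potential with unit drift away from a target\<close>

text \<open>A unit of flow along a path from \<open>T\<close> to \<open>A\<close>, divided by the edge weights since \<open>d\<^sup>*\<close> multiplies by
  them. The path is built edge by edge.\<close>
lemma ex_unit_flow:
  assumes "(A, T) \<in> (E \<union> E\<inverse>)\<^sup>*"
  shows "\<exists>g. \<forall>B\<in>\<Xi>. mu B * grad_adj \<Xi> E lam mu g B = of_bool (B = A) - of_bool (B = T)"
  using assms
proof (induction rule: converse_rtrancl_induct)
  case base
  have "\<forall>B\<in>\<Xi>. mu B * grad_adj \<Xi> E lam mu (\<lambda>_ _. 0) B = of_bool (B = T) - of_bool (B = T)"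
    by (simp add: grad_adj_as_edge_sum)
  then show ?case by blast
next
  case (step A A')
  obtain g where g: "\<forall>B\<in>\<Xi>. mu B * grad_adj \<Xi> E lam mu g B = of_bool (B = A') - of_bool (B = T)"
    using step.IH by blast
  \<comment> \<open>The added edge is \<open>(P, Q)\<close> in the orientation of \<open>E\<close>, and \<open>c\<close> is the sign of the flow on it.\<close>
  obtain P Q :: 'a and c :: real where PQ: "(P, Q) \<in> E"
      and c: "c * (of_bool (B = Q) - of_bool (B = P)) = of_bool (B = A) - of_bool (B = A')" for B
  proof (cases "(A, A') \<in> E")
    case True
    then show ?thesis by (intro that[of A A' "-1"]) auto
  next
    case False
    then show ?thesis using step.hyps(1) by (intro that[of A' A 1]) auto
  qed
  define h where "h B C = g B C + (if (B, C) = (P, Q) then c / lam P Q else 0)" for B C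
  have "mu B * grad_adj \<Xi> E lam mu h B = of_bool (B = A) - of_bool (B = T)" if B: "B \<in> \<Xi>" for B
  proof -
    have "mu B * grad_adj \<Xi> E lam mu h B = mu B * grad_adj \<Xi> E lam mu g B +
       (\<Sum>e\<in>E. if e = (P, Q) then c * (of_bool (B = Q) - of_bool (B = P)) else 0)"
      unfolding grad_adj_as_edge_sum[OF B] sum.distrib[symmetric]
      using edge_weight_pos[OF PQ]
      by (intro sum.cong refl) (simp add: h_def algebra_simps split: prod.splits if_splits)
    then show ?thesis
      using g B PQ finite_edges by (simp add: sum.delta c)
  qed
  then show ?case by blast
qed

text \<open>If \<open>C\<close> is the component of \<open>T\<close> without \<open>T\<close>, then \<open>w\<close> is, up to a constant, the expected time to hit
  \<open>T\<close>. Superposing unit flows from \<open>T\<close>, one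
  of strength \<open>conductance A\<close> to each \<open>A\<close> in \<open>C\<close>, gives an edge function with drift \<open>- 1\<close> on \<open>C\<close>, and
  \<open>ex_potential\<close> turns it into a gradient.\<close>
lemma ex_time_potential:
  assumes "C \<subseteq> \<Xi>" and "\<And>A. A \<in> C \<Longrightarrow> (A, T) \<in> (E \<union> E\<inverse>)\<^sup>*" and "T \<notin> C"
  shows "\<exists>w. \<forall>A\<in>C. drift (grad w) A = -1"
proof -
  obtain G where G: "\<And>A B. A \<in> C \<Longrightarrow> B \<in> \<Xi> \<Longrightarrow>
      mu B * grad_adj \<Xi> E lam mu (G A) B = of_bool (B = A) - of_bool (B = T)"
    using ex_unit_flow[OF assms(2)] by metis
  define g where "g P Q = (\<Sum>A\<in>C. conductance A * G A P Q)" for P Q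
  have fin: "finite C" using assms(1) finite_vertices finite_subset by blast
  obtain w where w: "\<forall>A\<in>\<Xi>. grad_adj \<Xi> E lam mu (grad w) A = grad_adj \<Xi> E lam mu g A"
    using ex_potential by blast
  have "drift (grad w) B = -1" if B: "B \<in> C" for B
  proof -
    have B': "B \<in> \<Xi>" using B assms(1) by auto
    have "mu B * grad_adj \<Xi> E lam mu g B
        = (\<Sum>A\<in>C. conductance A * (mu B * grad_adj \<Xi> E lam mu (G A) B))"
      unfolding grad_adj_as_edge_sum[OF B'] g_def sum_distrib_left
      by (subst sum.swap, intro sum.cong refl)
        (auto simp: sum_distrib_left split_beta algebra_simps intro!: sum.cong)
    also have "\<dots> = (\<Sum>A\<in>C. if B = A then conductance A else 0)"
      using B assms(3) by (intro sum.cong refl) (auto simp: G B')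
    finally have "conductance B * drift (grad w) B = - conductance B"
      using B fin w B' by (simp add: conductance_drift_grad)
    moreover have "(B, T) \<in> (E \<union> E\<inverse>)\<^sup>*" "B \<noteq> T" using assms B by auto
    then obtain U where "(B, U) \<in> E \<union> E\<inverse>" by (metis converse_rtranclE)
    then have "conductance B > 0"
      by (intro conductance_pos[of U]) (auto simp: adjacent_def)
    ultimately show ?thesis
      by (metis less_irrefl mult_cancel_left mult_minus1_right)
  qed
  then show ?thesis by blast
qed

end

section \<open>The walk stopped at its target\<close>

text \<open>Here \<open>m\<close> is the minimum of \<open>N\<close> and the first time at which \<open>x\<close> takes the value \<open>T\<close>. The bound on \<open>m\<close>
  and the two implications say so in a form that passes through the induction on \<open>N\<close>.\<close>
lemma stopped_telescope:
  fixes x :: "nat \<Rightarrow> 'b" and u :: "'b \<Rightarrow> real"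
  shows "\<exists>m\<le>N. (\<Sum>n<N. if \<forall>i\<le>n. x i \<noteq> T then u (x (Suc n)) - u (x n) else 0) = u (x m) - u (x 0)
    \<and> ((\<forall>i<N. x i \<noteq> T) \<longrightarrow> m = N) \<and> ((\<exists>i\<le>N. x i = T) \<longrightarrow> x m = T)"
proof (induction N)
  case 0
  show ?case by simp
next
  case (Suc N)
  then obtain m where m: "m \<le> N"
    "(\<Sum>n<N. if \<forall>i\<le>n. x i \<noteq> T then u (x (Suc n)) - u (x n) else 0) = u (x m) - u (x 0)"
    "(\<forall>i<N. x i \<noteq> T) \<longrightarrow> m = N" "(\<exists>i\<le>N. x i = T) \<longrightarrow> x m = T" by blast
  show ?case
  proof (cases "\<forall>i\<le>N. x i \<noteq> T")
    case True
    then have "m = N" using m(3) by auto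
    then show ?thesis
      using True m(2) by (intro exI[of _ "Suc N"]) (auto simp: le_Suc_eq)
  next
    case False
    then show ?thesis
      using m by (intro exI[of _ m]) (auto simp: less_Suc_eq_le)
  qed
qed

text \<open>At an isolated starting vertex the first step is unconstrained, and the Poisson equation is
  trivial there.\<close>
locale graph_walk = weighted_oriented_graph +
  fixes S :: 'a and M :: "'w measure" and X :: "nat \<Rightarrow> 'w \<Rightarrow> 'a"
  assumes walk: "canonical_chain \<Xi> E lam M S X"
    and start_not_isolated: "\<exists>U. adjacent E U S"
begin

sublocale prob_space M
  using walk by (simp add: canonical_chain_def)

abbreviation K :: "'a set" where "K \<equiv> component \<Xi> E S"

lemma X_vertex: "\<omega> \<in> space M \<Longrightarrow> X n \<omega> \<in> \<Xi>"
  using walk unfolding canonical_chain_def by (metis measurable_space space_count_space)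

lemma X_start: "\<omega> \<in> space M \<Longrightarrow> X 0 \<omega> = S"
  using walk unfolding canonical_chain_def by blast

lemma X_eq_measurable [measurable]: "Measurable.pred M (\<lambda>\<omega>. X n \<omega> = A)"
proof -
  have "X n -` ({A} \<inter> \<Xi>) \<inter> space M \<in> sets M"
    using walk unfolding canonical_chain_def by (intro measurable_sets[of _ _ "count_space \<Xi>"]) auto
  also have "X n -` ({A} \<inter> \<Xi>) \<inter> space M = {\<omega> \<in> space M. X n \<omega> = A}"
    using X_vertex by auto
  finally show ?thesis by (simp add: pred_def)
qed

lemma component_adjacent:
  assumes "A \<in> K" "adjacent E A B" shows "B \<in> K"
proof -
  have "(A, B) \<in> E \<union> E\<inverse>" using assms(2) by (auto simp: adjacent_def)
  then show ?thesis
    using assms adjacent_vertices[of A B]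
    by (auto simp: component_def simp del: Un_iff intro: rtrancl_into_rtrancl)
qed

lemma component_not_isolated:
  assumes "A \<in> K" shows "\<exists>U. adjacent E U A"
proof (cases "A = S")
  case True
  then show ?thesis using start_not_isolated by simp
next
  case False
  then obtain U where "(U, A) \<in> E \<union> E\<inverse>"
    using assms unfolding component_def by (metis (no_types, lifting) mem_Collect_eq rtranclE)
  then show ?thesis by (auto simp: adjacent_def)
qed

text \<open>The definition of the chain gives the transition law conditionally on a complete history. Summing
  over the finitely many histories in \<open>C\<close> that end at \<open>A\<close> gives it conditionally on such an event.\<close>
lemma markov_step:
  assumes "\<exists>U. adjacent E U A"
  shows "prob {\<omega> \<in> space M. (\<forall>i\<le>n. X i \<omega> \<in> C) \<and> X n \<omega> = A \<and> X (Suc n) \<omega> = B}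
       = prob {\<omega> \<in> space M. (\<forall>i\<le>n. X i \<omega> \<in> C) \<and> X n \<omega> = A} * trans_prob \<Xi> E lam A B"
proof -
  define H where "H = {x \<in> {..n} \<rightarrow>\<^sub>E \<Xi>. (\<forall>i\<le>n. x i \<in> C) \<and> x n = A}"
  define past where "past x = {\<omega> \<in> space M. \<forall>i\<le>n. X i \<omega> = x i}" for x
  define future where "future x = {\<omega> \<in> space M. (\<forall>i\<le>n. X i \<omega> = x i) \<and> X (Suc n) \<omega> = B}" for x
  have fin: "finite H"
    unfolding H_def using finite_PiE[of "{..n}" "\<lambda>_. \<Xi>"] finite_vertices by simp
  have sets: "past x \<in> sets M" "future x \<in> sets M" for x
    unfolding past_def future_def by measurable
  have dis: "disjoint_family_on past H" "disjoint_family_on future H"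
    unfolding disjoint_family_on_def H_def past_def future_def
    by (auto simp: PiE_iff intro!: extensionalityI)
  have hist: "\<exists>x\<in>H. \<forall>i\<le>n. X i \<omega> = x i"
    if "\<omega> \<in> space M" "\<forall>i\<le>n. X i \<omega> \<in> C" "X n \<omega> = A" for \<omega>
    using that X_vertex by (intro bexI[of _ "restrict (\<lambda>i. X i \<omega>) {..n}"]) (auto simp: H_def)
  have "{\<omega> \<in> space M. (\<forall>i\<le>n. X i \<omega> \<in> C) \<and> X n \<omega> = A} = (\<Union>x\<in>H. past x)"
    using hist by (fastforce simp: past_def H_def)
  moreover have "{\<omega> \<in> space M. (\<forall>i\<le>n. X i \<omega> \<in> C) \<and> X n \<omega> = A \<and> X (Suc n) \<omega> = B}
      = (\<Union>x\<in>H. future x)"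
    using hist by (fastforce simp: future_def H_def)
  moreover have "prob (future x) = prob (past x) * trans_prob \<Xi> E lam A B" if "x \<in> H" for x
    using walk assms that unfolding canonical_chain_def past_def future_def H_def by auto
  ultimately show ?thesis
    using finite_measure_finite_Union[OF fin _ dis(1)] finite_measure_finite_Union[OF fin _ dis(2)] sets
    by (simp add: image_subset_iff sum_distrib_right)
qed

text \<open>No step leaves the component with positive probability, so the walk, which starts in it, is almost
  surely in it at every time.\<close>
lemma prob_outside_component:
  assumes "A \<notin> K" shows "prob {\<omega> \<in> space M. X n \<omega> = A} = 0"
  using assms
proof (induction n arbitrary: A)
  case 0
  have "S \<in> K"
    using start_not_isolated adjacent_vertices by (auto simp: component_def)
  then have "{\<omega> \<in> space M. X 0 \<omega> = A} = {}" using 0 X_start by auto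
  then show ?case by (simp only: measure_empty)
next
  case (Suc n)
  have zero: "prob {\<omega> \<in> space M. X n \<omega> = B \<and> X (Suc n) \<omega> = A} = 0" for B
  proof (cases "B \<in> K")
    case True
    then have "trans_prob \<Xi> E lam B A = 0"
      using component_adjacent Suc.prems by (auto simp: trans_prob_def adjacent_commute)
    then show ?thesis
      using markov_step[OF component_not_isolated[OF True], of n UNIV A] by simp
  next
    case False
    have "prob {\<omega> \<in> space M. X n \<omega> = B \<and> X (Suc n) \<omega> = A} \<le> prob {\<omega> \<in> space M. X n \<omega> = B}"
      by (intro finite_measure_mono) auto
    then show ?thesis using Suc.IH[OF False] by (simp add: measure_le_0_iff)
  qed
  have "prob {\<omega> \<in> space M. X (Suc n) \<omega> = A}
      \<le> prob (\<Union>B\<in>\<Xi>. {\<omega> \<in> space M. X n \<omega> = B \<and> X (Suc n) \<omega> = A})"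
    using X_vertex finite_vertices by (intro finite_measure_mono) auto
  also have "\<dots> \<le> (\<Sum>B\<in>\<Xi>. prob {\<omega> \<in> space M. X n \<omega> = B \<and> X (Suc n) \<omega> = A})"
    using finite_vertices by (intro finite_measure_subadditive_finite) auto
  finally show ?case by (simp add: zero measure_le_0_iff)
qed

text \<open>The contribution of the step from time \<open>n\<close> to \<open>n + 1\<close> to the sum of \<open>k\<close> up to the hitting time of
  \<open>T\<close>. It counts exactly if that time exceeds \<open>n\<close>, so that the sum over a random number of steps
  becomes a series over all \<open>n\<close>.\<close>
definition stopped_term :: "'a \<Rightarrow> ('a \<Rightarrow> 'a \<Rightarrow> real) \<Rightarrow> nat \<Rightarrow> 'w \<Rightarrow> real" where
  "stopped_term T k n \<omega> = (if \<forall>i\<le>n. X i \<omega> \<noteq> T then k (X n \<omega>) (X (Suc n) \<omega>) else 0)"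

abbreviation alive :: "'a \<Rightarrow> nat \<Rightarrow> 'w set" where
  "alive T n \<equiv> {\<omega> \<in> space M. \<forall>i\<le>n. X i \<omega> \<noteq> T}"

text \<open>There are finitely many possible steps, so each term is a simple function, which settles its
  measurability and integrability.\<close>
lemma stopped_term_as_sum:
  assumes "\<omega> \<in> space M"
  shows "stopped_term T k n \<omega> = (\<Sum>A\<in>\<Xi>. \<Sum>B\<in>\<Xi>. k A B *
    indicator {\<omega> \<in> space M. (\<forall>i\<le>n. X i \<omega> \<noteq> T) \<and> X n \<omega> = A \<and> X (Suc n) \<omega> = B} \<omega>)"
proof (cases "\<forall>i\<le>n. X i \<omega> \<noteq> T")
  case True
  have "(\<Sum>A\<in>\<Xi>. \<Sum>B\<in>\<Xi>. k A B *
      indicator {\<omega> \<in> space M. (\<forall>i\<le>n. X i \<omega> \<noteq> T) \<and> X n \<omega> = A \<and> X (Suc n) \<omega> = B} \<omega>)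
    = (\<Sum>A\<in>\<Xi>. \<Sum>B\<in>\<Xi>. if X (Suc n) \<omega> = B then if X n \<omega> = A then k A B else 0 else 0)"
    using True assms by (intro sum.cong refl) (auto simp: indicator_def)
  also have "\<dots> = k (X n \<omega>) (X (Suc n) \<omega>)"
    using finite_vertices X_vertex[OF assms] by simp
  finally show ?thesis using True by (simp add: stopped_term_def)
next
  case False
  then have "\<omega> \<notin> {\<omega> \<in> space M. (\<forall>i\<le>n. X i \<omega> \<noteq> T) \<and> X n \<omega> = A \<and> X (Suc n) \<omega> = B}" for A B
    by auto
  then show ?thesis using False by (auto simp: stopped_term_def)
qed

lemma integrable_stopped_term: "integrable M (stopped_term T k n)"
  by (subst Bochner_Integration.integrable_cong[OF refl stopped_term_as_sum])
    (auto intro!: Bochner_Integration.integrable_sum integrable_mult_right integrable_real_indicator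
      simp: emeasure_eq_measure)

text \<open>The key point: the right-hand side depends on \<open>k\<close> only through its drift on the component away
  from \<open>T\<close>, because not having hit \<open>T\<close> by time \<open>n\<close> is decided before the next step is taken.\<close>
lemma expectation_stopped_term:
  "expectation (stopped_term T k n) =
    (\<Sum>A\<in>K - {T}. prob {\<omega> \<in> space M. (\<forall>i\<le>n. X i \<omega> \<noteq> T) \<and> X n \<omega> = A} * drift k A)"
proof -
  define here where "here A = {\<omega> \<in> space M. (\<forall>i\<le>n. X i \<omega> \<noteq> T) \<and> X n \<omega> = A}" for A
  define step where
    "step A B = {\<omega> \<in> space M. (\<forall>i\<le>n. X i \<omega> \<noteq> T) \<and> X n \<omega> = A \<and> X (Suc n) \<omega> = B}" for A B
  have sets: "here A \<in> sets M" "step A B \<in> sets M" for A B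
    unfolding here_def step_def by measurable
  have null: "prob (here A) = 0" if "A \<notin> K - {T}" for A
  proof (cases "A = T")
    case True
    then have "here A = {}" by (auto simp: here_def)
    then show ?thesis by simp
  next
    case False
    have "prob (here A) \<le> prob {\<omega> \<in> space M. X n \<omega> = A}"
      unfolding here_def by (intro finite_measure_mono) auto
    then show ?thesis using prob_outside_component[of A n] that False by (simp add: measure_le_0_iff)
  qed
  have step: "prob (step A B) = prob (here A) * trans_prob \<Xi> E lam A B" for A B
  proof (cases "A \<in> K")
    case True
    then show ?thesis
      using markov_step[OF component_not_isolated[OF True], of n "- {T}" B]
      by (simp add: step_def here_def)
  next
    case False
    have "prob (step A B) \<le> prob (here A)"
      using sets by (intro finite_measure_mono) (auto simp: step_def here_def)
    then show ?thesis using null[of A] False by (simp add: measure_le_0_iff)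
  qed
  have "expectation (stopped_term T k n)
      = expectation (\<lambda>\<omega>. \<Sum>A\<in>\<Xi>. \<Sum>B\<in>\<Xi>. k A B * indicator (step A B) \<omega>)"
    unfolding step_def by (intro Bochner_Integration.integral_cong refl stopped_term_as_sum)
  also have "\<dots> = (\<Sum>A\<in>\<Xi>. \<Sum>B\<in>\<Xi>. k A B * prob (step A B))"
    using sets sets.sets_into_space by (simp add: Bochner_Integration.integral_sum emeasure_eq_measure Int_absorb2)
  also have "\<dots> = (\<Sum>A\<in>\<Xi>. prob (here A) * drift k A)"
    by (simp add: step drift_def sum_distrib_left algebra_simps)
  also have "\<dots> = (\<Sum>A\<in>K - {T}. prob (here A) * drift k A)"
    using finite_vertices null by (intro sum.mono_neutral_right) (auto simp: component_def)
  finally show ?thesis unfolding here_def .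
qed

lemma prob_alive: "prob (alive T n) = expectation (stopped_term T (\<lambda>_ _. 1) n)"
proof -
  have "expectation (stopped_term T (\<lambda>_ _. 1) n) = expectation (indicator (alive T n))"
    by (intro Bochner_Integration.integral_cong) (auto simp: stopped_term_def indicator_def)
  then show ?thesis by simp
qed

lemma component_connected: "A \<in> K \<Longrightarrow> B \<in> K \<Longrightarrow> (A, B) \<in> (E \<union> E\<inverse>)\<^sup>*"
proof -
  assume "A \<in> K" "B \<in> K"
  moreover have "sym ((E \<union> E\<inverse>)\<^sup>*)" by (intro sym_rtrancl) (auto simp: sym_def)
  ultimately show ?thesis unfolding component_def by (auto dest: symD intro: rtrancl_trans)
qed

text \<open>The sum of these probabilities is the mean hitting time of \<open>T\<close>. Its partial sums are the expected
  decreases of the bounded function \<open>w\<close> along the stopped walk.\<close>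
lemma summable_alive:
  assumes "T \<in> K" shows "summable (\<lambda>n. prob (alive T n))"
proof -
  obtain w where w: "\<And>A. A \<in> K - {T} \<Longrightarrow> drift (grad w) A = -1"
  proof -
    have "K - {T} \<subseteq> \<Xi>" by (auto simp: component_def)
    then show ?thesis
      using ex_time_potential[of "K - {T}" T] component_connected[OF _ assms] that by blast
  qed
  define W where "W = (\<Sum>A\<in>\<Xi>. \<bar>w A\<bar>)"
  have W: "\<bar>w A\<bar> \<le> W" if "A \<in> \<Xi>" for A
    unfolding W_def using finite_vertices that by (intro member_le_sum) auto
  have alive: "prob (alive T n) = - expectation (stopped_term T (grad w) n)" for n
    unfolding prob_alive expectation_stopped_term sum_negf[symmetric]
    using component_not_isolated drift_one by (intro sum.cong refl) (auto simp: w)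
  show ?thesis
  proof (rule summableI_nonneg_bounded)
    fix N
    have "- (\<Sum>n<N. stopped_term T (grad w) n \<omega>) \<le> 2 * W" if "\<omega> \<in> space M" for \<omega>
    proof -
      obtain m where "(\<Sum>n<N. stopped_term T (grad w) n \<omega>) = w (X m \<omega>) - w (X 0 \<omega>)"
        using stopped_telescope[where x = "\<lambda>i. X i \<omega>" and u = w and N = N and T = T]
        unfolding stopped_term_def grad_def by blast
      then show ?thesis using W[OF X_vertex[OF that, of m]] W[OF X_vertex[OF that, of 0]] by auto
    qed
    then have "expectation (\<lambda>\<omega>. - (\<Sum>n<N. stopped_term T (grad w) n \<omega>)) \<le> 2 * W"
      by (intro integral_le_const) (auto intro: integrable_stopped_term)
    moreover have "expectation (\<lambda>\<omega>. - (\<Sum>n<N. stopped_term T (grad w) n \<omega>))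
        = (\<Sum>n<N. prob (alive T n))"
      by (simp add: Bochner_Integration.integral_sum integrable_stopped_term alive sum_negf)
    ultimately show "(\<Sum>n<N. prob (alive T n)) \<le> 2 * W" by simp
  qed simp
qed

lemma AE_hits:
  assumes "T \<in> K" shows "AE \<omega> in M. \<exists>n. X n \<omega> = T"
proof -
  define never where "never = {\<omega> \<in> space M. \<forall>n. X n \<omega> \<noteq> T}"
  have never: "never \<in> sets M" unfolding never_def by measurable
  have "prob never \<le> prob (alive T n)" for n
    by (intro finite_measure_mono) (auto simp: never_def)
  then have "prob never \<le> 0"
    using summable_LIMSEQ_zero[OF summable_alive[OF assms]] by (intro LIMSEQ_le_const) auto
  then have "AE \<omega> in M. \<omega> \<notin> never"
    using never by (intro AE_not_in) (auto simp: null_sets_def emeasure_eq_measure measure_le_0_iff)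
  then show ?thesis by (auto simp: never_def)
qed

lemma stopped_terms_vanish:
  assumes "X m \<omega> = T" "m \<le> n" shows "stopped_term T k n \<omega> = 0"
  using assms by (auto simp: stopped_term_def)

text \<open>Dominated convergence: the absolute values of the terms have summable expectations, since \<open>k\<close> is
  bounded on pairs of vertices and the hitting time has finite mean.\<close>
lemma expectation_stopped_sums:
  assumes "T \<in> K"
  shows "(\<lambda>n. expectation (stopped_term T k n)) sums expectation (\<lambda>\<omega>. \<Sum>n. stopped_term T k n \<omega>)"
proof (rule sums_integral[OF integrable_stopped_term])
  show "AE \<omega> in M. summable (\<lambda>n. norm (stopped_term T k n \<omega>))"
    using AE_hits[OF assms]
  proof eventually_elim
    case (elim \<omega>)
    then obtain m where "X m \<omega> = T" by blast
    then show ?case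
      by (intro summable_finite[of "{..<m}"]) (auto simp: stopped_terms_vanish not_less)
  qed
next
  define c where "c = (\<Sum>A\<in>\<Xi>. \<Sum>B\<in>\<Xi>. \<bar>k A B\<bar>)"
  have c: "\<bar>k A B\<bar> \<le> c" if "A \<in> \<Xi>" "B \<in> \<Xi>" for A B
  proof -
    have "\<bar>k A B\<bar> \<le> (\<Sum>B\<in>\<Xi>. \<bar>k A B\<bar>)"
      using finite_vertices that by (intro member_le_sum) auto
    also have "\<dots> \<le> c"
      unfolding c_def using finite_vertices that
      by (intro member_le_sum[of A _ "\<lambda>A. \<Sum>B\<in>\<Xi>. \<bar>k A B\<bar>"]) (auto simp: sum_nonneg)
    finally show ?thesis .
  qed
  have pointwise: "norm (stopped_term T k n \<omega>) \<le> c * stopped_term T (\<lambda>_ _. 1) n \<omega>"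
    if "\<omega> \<in> space M" for n \<omega>
    using c[OF X_vertex[OF that, of n] X_vertex[OF that, of "Suc n"]]
    by (auto simp: stopped_term_def)
  have "expectation (\<lambda>\<omega>. norm (stopped_term T k n \<omega>)) \<le> c * prob (alive T n)" for n
  proof -
    have "expectation (\<lambda>\<omega>. norm (stopped_term T k n \<omega>))
        \<le> expectation (\<lambda>\<omega>. c * stopped_term T (\<lambda>_ _. 1) n \<omega>)"
      by (intro integral_mono integrable_norm integrable_mult_right integrable_stopped_term pointwise)
    then show ?thesis by (simp add: prob_alive)
  qed
  then show "summable (\<lambda>n. expectation (\<lambda>\<omega>. norm (stopped_term T k n \<omega>)))"
    by (intro summable_comparison_test'[OF summable_mult[OF summable_alive[OF assms], of c]]) simp
qed

text \<open>On a trajectory that never hits \<open>T\<close> the two sides may differ: the hitting time is then \<open>0\<close> by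
  convention, whereas the series runs over all steps.\<close>
lemma path_integral_eq_stopped_sum:
  assumes "X m \<omega> = T"
  shows "path_integral E X f T \<omega> = (\<Sum>n. stopped_term T (flow_ext E f) n \<omega>)"
proof -
  define \<tau> where "\<tau> = (LEAST n. X n \<omega> = T)"
  have hit: "X \<tau> \<omega> = T" unfolding \<tau>_def using assms by (rule LeastI)
  have before: "X i \<omega> \<noteq> T" if "i < \<tau>" for i
    using that not_less_Least unfolding \<tau>_def by blast
  have "hitting_time X T \<omega> = \<tau>" using assms by (auto simp: hitting_time_def \<tau>_def)
  then have "path_integral E X f T \<omega> = (\<Sum>n<\<tau>. flow_ext E f (X n \<omega>) (X (Suc n) \<omega>))"
    unfolding path_integral_def by (simp add: sum.atLeast1_atMost_eq)
  also have "\<dots> = (\<Sum>n<\<tau>. stopped_term T (flow_ext E f) n \<omega>)"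
    using before by (intro sum.cong) (auto simp: stopped_term_def)
  also have "\<dots> = (\<Sum>n. stopped_term T (flow_ext E f) n \<omega>)"
    using hit by (intro suminf_finite[symmetric]) (auto simp: stopped_terms_vanish not_less)
  finally show ?thesis .
qed

lemma value_fun_eq_stopped_sum:
  assumes "T \<in> K"
  shows "value_fun E M X f T = expectation (\<lambda>\<omega>. \<Sum>n. stopped_term T (flow_ext E f) n \<omega>)"
proof -
  have meas [measurable]: "(\<lambda>\<omega>. \<Sum>n. stopped_term T (flow_ext E f) n \<omega>) \<in> borel_measurable M"
    by (intro borel_measurable_suminf borel_measurable_integrable integrable_stopped_term)
  have "path_integral E X f T \<omega> = (if \<exists>n. X n \<omega> = T
      then \<Sum>n. stopped_term T (flow_ext E f) n \<omega> else 0)" for \<omega>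
  proof (cases "\<exists>n. X n \<omega> = T")
    case True
    then show ?thesis using path_integral_eq_stopped_sum by auto
  next
    case False
    then show ?thesis by (simp add: path_integral_def hitting_time_def)
  qed
  then have "path_integral E X f T = (\<lambda>\<omega>. if \<exists>n. X n \<omega> = T
      then \<Sum>n. stopped_term T (flow_ext E f) n \<omega> else 0)" ..
  then have path_meas: "path_integral E X f T \<in> borel_measurable M" by simp
  then show ?thesis
    unfolding value_fun_def
  proof (intro integral_cong_AE path_meas meas)
    show "AE \<omega> in M. path_integral E X f T \<omega> = (\<Sum>n. stopped_term T (flow_ext E f) n \<omega>)"
      using AE_hits[OF assms] by eventually_elim (auto simp: path_integral_eq_stopped_sum)
  qed
qed

lemma stopped_grad_sum:
  assumes "\<omega> \<in> space M" "X m \<omega> = T"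
  shows "(\<Sum>n. stopped_term T (grad u) n \<omega>) = u T - u S"
proof -
  have "(\<Sum>n. stopped_term T (grad u) n \<omega>) = (\<Sum>n<m. stopped_term T (grad u) n \<omega>)"
    using assms by (intro suminf_finite) (auto simp: stopped_terms_vanish not_less)
  also have "\<dots> = u T - u S"
    using stopped_telescope[where x = "\<lambda>i. X i \<omega>" and u = u and N = m and T = T] assms X_start
    unfolding stopped_term_def grad_def by auto
  finally show ?thesis .
qed

text \<open>The edge functions \<open>f\<close> and \<open>grad \<phi>\<close> have the same drift, hence the same expected sum up to the
  hitting time of \<open>T\<close>; for \<open>grad \<phi>\<close> this sum telescopes almost surely.\<close>
lemma value_fun_eq_potential_difference:
  assumes \<phi>: "\<forall>A\<in>\<Xi>. grad_adj \<Xi> E lam mu (grad \<phi>) A = grad_adj \<Xi> E lam mu f A"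
    and T: "T \<in> K"
  shows "value_fun E M X f T = \<phi> T - \<phi> S"
proof -
  have drift: "drift (flow_ext E f) A = drift (grad \<phi>) A" if A: "A \<in> K" for A
  proof -
    have "A \<in> \<Xi>" using A by (simp add: component_def)
    then have "conductance A * drift (flow_ext E f) A = conductance A * drift (grad \<phi>) A"
      using \<phi> by (simp add: conductance_drift_flow_ext conductance_drift_grad)
    moreover have "conductance A > 0"
      using component_not_isolated[OF A] conductance_pos by blast
    ultimately show ?thesis by simp
  qed
  have "expectation (stopped_term T (flow_ext E f) n) = expectation (stopped_term T (grad \<phi>) n)" for n
    unfolding expectation_stopped_term by (intro sum.cong refl) (simp add: drift)
  then have "value_fun E M X f T = expectation (\<lambda>\<omega>. \<Sum>n. stopped_term T (grad \<phi>) n \<omega>)"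
    using sums_unique2[OF expectation_stopped_sums[OF T, of "flow_ext E f"]]
      expectation_stopped_sums[OF T, of "grad \<phi>"]
    by (simp add: value_fun_eq_stopped_sum[OF T])
  also have "\<dots> = expectation (\<lambda>_. \<phi> T - \<phi> S)"
  proof (intro integral_cong_AE borel_measurable_suminf borel_measurable_integrable
      integrable_stopped_term)
    show "AE \<omega> in M. (\<Sum>n. stopped_term T (grad \<phi>) n \<omega>) = \<phi> T - \<phi> S"
      using AE_hits[OF T] AE_space by eventually_elim (use stopped_grad_sum in blast)
  qed simp
  finally show ?thesis by (simp add: prob_space)
qed

end

section \<open>The value function solves the Poisson equation\<close>

theorem theorem2p4:
  fixes \<Xi> :: "'a set" and E :: "('a \<times> 'a) set"
    and lam :: "'a \<Rightarrow> 'a \<Rightarrow> real" and mu :: "'a \<Rightarrow> real"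
    and f :: "'a \<Rightarrow> 'a \<Rightarrow> real" and S :: 'a
    and M :: "'w measure" and X :: "nat \<Rightarrow> 'w \<Rightarrow> 'a"
  assumes "weighted_oriented_graph \<Xi> E lam mu"
    and "S \<in> \<Xi>"
    and "canonical_chain \<Xi> E lam M S X"
  shows "\<forall>T\<in>component \<Xi> E S.
           grad_adj \<Xi> E lam mu (grad (value_fun E M X f)) T = grad_adj \<Xi> E lam mu f T"
proof
  interpret weighted_oriented_graph \<Xi> E lam mu by (rule assms(1))
  fix T assume T: "T \<in> component \<Xi> E S"
  show "grad_adj \<Xi> E lam mu (grad (value_fun E M X f)) T = grad_adj \<Xi> E lam mu f T"
  proof (cases "\<exists>U. adjacent E U S")
    case False
    then have "T = S"
      using T unfolding component_def
      by (metis (no_types, lifting) Un_iff adjacent_def converseD converse_rtranclE mem_Collect_eq)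
    then show ?thesis using False by (simp add: grad_adj_def)
  next
    case True
    interpret graph_walk \<Xi> E lam mu S M X
      using True assms(3) by unfold_locales
    obtain \<phi> where \<phi>: "\<forall>A\<in>\<Xi>. grad_adj \<Xi> E lam mu (grad \<phi>) A = grad_adj \<Xi> E lam mu f A"
      using ex_potential by blast
    \<comment> \<open>The operator at \<open>T\<close> sees only \<open>T\<close> and its neighbours, where the two functions differ by a
      constant.\<close>
    have "value_fun E M X f U = \<phi> U - \<phi> S" if "U = T \<or> adjacent E U T" for U
      using that T component_adjacent[OF T, of U]
      by (intro value_fun_eq_potential_difference[OF \<phi>]) (auto simp: adjacent_commute)
    then have "grad_adj \<Xi> E lam mu (grad (value_fun E M X f)) T = grad_adj \<Xi> E lam mu (grad \<phi>) T"
      unfolding grad_adj_def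
      by (intro sum.cong refl) (auto simp: flow_ext_def grad_def)
    then show ?thesis using \<phi> T by (simp add: component_def)
  qed
qed

end
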